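(* Let $K\subset L$ be an extension of fields (possibly skew), with $K$ commutative and central in $L$. Then $L$ has the linear matching property if and only if $L$ contains no proper finite-dimensional extension over $K$, i.e. there is no (possibly skew) field $M$ with $K\subsetneq M\subsetneq L$ and $\dim_K M<\infty$.
   Context: "Field" means a division ring (skew field); a "commutative field" is a field with commutative multiplication. $K$ is central in $L$ if $\lambda x=x\lambda$ for all $\lambda\in K$, $x\in L$. Intermediate fields $M$ are sub-division-rings of $L$ containing $K$. The extension $L$ of $K$ may be finite- or infinite-dimensional. Let $A,B$ be $n$-dimensional $K$-subspaces of $L$, with (indexed) bases $\mathcal{A}=\{a_1,\ldots,a_n\}$ of $A$ and $\mathcal{B}=\{b_1,\ldots,b_n\}$ of $B$. We say that $\mathcal{A}$ is matched to $\mathcal{B}$ if for all $i=1,\ldots,n$ and all $b\in B$: $a_ib\in A$ implies $b\in\langle b_1,\ldots,\widehat{b_i},\ldots,b_n\rangle$; equivalently, $a_i^{-1}A\cap B\subset\langle b_1,\ldots,\widehat{b_i},\ldots,b_n\rangle$ for all $i$. Here $\langle b_1,\ldots,\widehat{b_i},\ldots,b_n\rangle$ is the $K$-subspace spanned by the $b_j$ with $j\neq i$. We say that $A$ is matched to $B$ if every basis $\mathcal{A}$ of $A$ can be matched to some basis $\mathcal{B}$ of $B$ (i.e. for every basis $\mathcal{A}$ there exists a basis $\mathcal{B}$ of $B$ such that $\mathcal{A}$ is matched to $\mathcal{B}$). $L$ (as an extension of $K$) has the linear matching property if, for every $n\ge 1$ and all $n$-dimensional $K$-subspaces $A,B$ of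 $L$ with $1\notin B$, the subspace $A$ is matched to $B$. *)

theory Defs
  imports Complex_Main
begin

text \<open>
  The inclusion of \<open>K\<close> in \<open>L\<close> is a unital ring homomorphism \<open>emb\<close> (injective, as \<open>K\<close> is a field);
  \<open>L\<close> is an arbitrary division ring, possibly noncommutative and possibly of infinite
  dimension over \<open>K\<close>.
\<close>

locale central_extension =
  fixes emb :: "'k::field \<Rightarrow> 'l::division_ring"
  assumes emb_one: "emb 1 = 1"
    and emb_add: "emb (c + d) = emb c + emb d"
    and emb_mult: "emb (c * d) = emb c * emb d"
    and emb_central: "emb c * x = x * emb c"
begin

definition scale :: "'k \<Rightarrow> 'l \<Rightarrow> 'l"
  where "scale c x = emb c * x"

sublocale K: vector_space scale
  by standard
    (simp_all add: scale_def emb_one emb_add emb_mult distrib_left distrib_right mult.assoc)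

text \<open>
  Finiteness is required separately because \<open>dim\<close> takes the value \<open>0\<close> on
  infinite-dimensional spaces.
\<close>

definition finite_dim_subspace :: "'l set \<Rightarrow> bool"
  where "finite_dim_subspace V \<longleftrightarrow> K.subspace V \<and> (\<exists>S. finite S \<and> K.span S = V)"

definition subspace_of_dim :: "nat \<Rightarrow> 'l set \<Rightarrow> bool"
  where "subspace_of_dim n V \<longleftrightarrow> finite_dim_subspace V \<and> K.dim V = n"

definition indexed_basis :: "nat \<Rightarrow> (nat \<Rightarrow> 'l) \<Rightarrow> 'l set \<Rightarrow> bool"
  where "indexed_basis n a V \<longleftrightarrow>
    inj_on a {1..n} \<and> K.independent (a ` {1..n}) \<and> K.span (a ` {1..n}) = V"

definition basis_matched ::
    "nat \<Rightarrow> 'l set \<Rightarrow> 'l set \<Rightarrow> (nat \<Rightarrow> 'l) \<Rightarrow> (nat \<Rightarrow> 'l) \<Rightarrow> bool"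
  where "basis_matched n A B a b \<longleftrightarrow>
    (\<forall>i\<in>{1..n}. \<forall>x\<in>B. a i * x \<in> A \<longrightarrow> x \<in> K.span (b ` ({1..n} - {i})))"

definition subspace_matched :: "nat \<Rightarrow> 'l set \<Rightarrow> 'l set \<Rightarrow> bool"
  where "subspace_matched n A B \<longleftrightarrow>
    (\<forall>a. indexed_basis n a A \<longrightarrow> (\<exists>b. indexed_basis n b B \<and> basis_matched n A B a b))"

definition linear_matching_property :: bool
  where "linear_matching_property \<longleftrightarrow>
    (\<forall>n\<ge>1. \<forall>A B. subspace_of_dim n A \<longrightarrow> subspace_of_dim n B \<longrightarrow> 1 \<notin> B \<longrightarrow>
      subspace_matched n A B)"

text \<open>
  Closure under \<open>inverse\<close> needs no side condition, since \<open>inverse 0 = 0\<close>; \<open>0\<close> and \<open>1\<close>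
  lie in \<open>M\<close> because \<open>K\<close> does.
\<close>

definition intermediate_field :: "'l set \<Rightarrow> bool"
  where "intermediate_field M \<longleftrightarrow>
    range emb \<subseteq> M \<and>
    (\<forall>x\<in>M. \<forall>y\<in>M. x - y \<in> M \<and> x * y \<in> M) \<and>
    (\<forall>x\<in>M. inverse x \<in> M)"

end

end

theory Submission
  imports Defs
begin

text \<open>
  By the dual form of Rado's theorem, a basis \<open>a\<close> of \<open>A\<close> is matched to some basis of \<open>B\<close> as soon as
  \<open>W = {x \<in> B. \<forall>j\<in>J. a j * x \<in> A}\<close> has dimension at most \<open>n - |J|\<close> for every set \<open>J\<close> of indices.
  With \<open>U\<close> the span of the \<open>a j\<close>, \<open>j \<in> J\<close>, and \<open>W' = K + W\<close>, where the sum is direct because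
  \<open>1 \<notin> B\<close>, we have \<open>U W' \<subseteq> A\<close>, so a Cauchy-Davenport type inequality
  \<open>dim U + dim W' \<le> dim A + 1\<close> is what is needed. An extremal counterexample to it, under the
  Kemperman transforms \<open>(X + X x, Y \<inter> x\<inverse> Y)\<close> and \<open>(X \<inter> X x\<inverse>, Y + x Y)\<close>, has a member which is a
  translate of a finite-dimensional intermediate field different from \<open>K\<close> and \<open>L\<close>.

  Conversely, if \<open>M = K \<oplus> M'\<close> is a proper finite-dimensional intermediate field and \<open>x \<notin> M\<close>, then
  \<open>M\<close> is not matched to \<open>M' \<oplus> K x\<close>: all the spans \<open>\<langle>b j | j \<noteq> i\<rangle>\<close> would have to equal \<open>M'\<close>.
\<close>

text \<open>\<open>V\<close> need not be a subspace, so that unions and sets with an added vector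
  can stand for sums of subspaces. The notion is carried as a side condition next to
  \<open>dim\<close>, which is 0 in infinite dimension.\<close>

definition (in vector_space) finite_dim :: "'b set \<Rightarrow> bool"
  where "finite_dim V \<longleftrightarrow> (\<exists>S. finite S \<and> V \<subseteq> span S)"

section \<open>Dimension of finite-dimensional sets of vectors\<close>

context vector_space
begin

lemma finite_dim_subset: "finite_dim W \<Longrightarrow> V \<subseteq> W \<Longrightarrow> finite_dim V"
  unfolding finite_dim_def by blast

lemma finite_dim_span [simp]: "finite_dim (span V) \<longleftrightarrow> finite_dim V"
  unfolding finite_dim_def by (meson span_minimal span_superset subspace_span subset_trans)

lemma finite_dim_Un [simp]: "finite_dim (V \<union> W) \<longleftrightarrow> finite_dim V \<and> finite_dim W"
proof
  assume "finite_dim V \<and> finite_dim W"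
  then obtain S T where "finite S" "finite T" "V \<subseteq> span S" "W \<subseteq> span T"
    unfolding finite_dim_def by blast
  then show "finite_dim (V \<union> W)"
    unfolding finite_dim_def
    by (intro exI[of _ "S \<union> T"]) (use span_mono[of S "S \<union> T"] span_mono[of T "S \<union> T"] in blast)
qed (auto intro: finite_dim_subset)

lemma finite_dim_finite: "finite V \<Longrightarrow> finite_dim V"
  unfolding finite_dim_def using span_superset by blast

lemma finite_dim_independent: "finite_dim V \<Longrightarrow> independent B \<Longrightarrow> B \<subseteq> span V \<Longrightarrow> finite B"
  unfolding finite_dim_def
  by (meson independent_span_bound span_minimal subspace_span subset_trans)

lemma finite_dim_basis_extend:
  assumes "finite_dim V" "independent D" "D \<subseteq> V"
  obtains B where "D \<subseteq> B" "B \<subseteq> V" "finite B" "independent B" "V \<subseteq> span B" "card B = dim V"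
proof -
  obtain B where B: "D \<subseteq> B" "B \<subseteq> V" "independent B" "V \<subseteq> span B"
    using maximal_independent_subset_extend[OF assms(3,2)] by metis
  moreover have "finite B"
    using finite_dim_independent[OF assms(1) B(3)] B(2) span_superset by blast
  ultimately show thesis
    using that basis_card_eq_dim by blast
qed

lemma finite_dim_basis:
  assumes "finite_dim V"
  obtains B where "B \<subseteq> V" "finite B" "independent B" "V \<subseteq> span B" "card B = dim V"
  using finite_dim_basis_extend[OF assms independent_empty] by auto

lemma dim_mono_finite:
  assumes "finite_dim W" "V \<subseteq> span W"
  shows "dim V \<le> dim W"
proof -
  obtain B where "B \<subseteq> W" "finite B" "W \<subseteq> span B" "card B = dim W"
    using finite_dim_basis[OF assms(1)] by metis
  then show ?thesis
    by (metis assms(2) dim_le_card span_minimal subspace_span subset_trans)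
qed

lemma dim_subset_finite: "finite_dim W \<Longrightarrow> V \<subseteq> W \<Longrightarrow> dim V \<le> dim W"
  using dim_mono_finite span_superset by blast

lemma dim_insert_finite:
  assumes "finite_dim V"
  shows "dim (insert x V) = (if x \<in> span V then dim V else Suc (dim V))"
proof (cases "x \<in> span V")
  case False
  obtain B where B: "B \<subseteq> V" "finite B" "independent B" "V \<subseteq> span B" "card B = dim V"
    using finite_dim_basis[OF assms] by metis
  have "x \<notin> span B" using False B(1) span_mono by blast
  then have "x \<notin> B" "independent (insert x B)"
    using B(3) independent_insertI span_base by blast+
  moreover have "insert x V \<subseteq> span (insert x B)"
    using B(4) span_mono[of B "insert x B"] span_base[of x "insert x B"] by blast
  ultimately have "card (insert x B) = dim (insert x V)"
    using B(1) by (intro basis_card_eq_dim) auto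
  then show ?thesis using False B \<open>x \<notin> B\<close> by simp
qed (metis dim_span span_redundant)

lemma subspace_dim_eq:
  assumes "finite_dim W" "subspace V" "V \<subseteq> W" "dim W \<le> dim V"
  shows "V = W"
proof (rule ccontr)
  assume "V \<noteq> W"
  then obtain x where x: "x \<in> W" "x \<notin> V" using assms(3) by blast
  then have "dim (insert x V) = Suc (dim V)"
    using assms(1-3) by (simp add: dim_insert_finite finite_dim_subset span_eq_iff[THEN iffD2])
  moreover have "dim (insert x V) \<le> dim W"
    using x assms by (intro dim_subset_finite) auto
  ultimately show False using assms(4) by simp
qed

lemma dim_zero [simp]: "dim {0} = 0"
  using dim_span[of "{}"] dim_eq_card_independent[OF independent_empty] by simp

lemma dim_pos:
  assumes "finite_dim V" "x \<in> V" "x \<noteq> 0"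
  shows "dim V > 0"
proof -
  have "dim {x} = 1" using assms(3) dim_eq_card_independent[of "{x}"] by simp
  then show ?thesis using dim_subset_finite[OF assms(1), of "{x}"] assms(2) by simp
qed

text \<open>The union stands for \<open>S + T\<close>, as \<open>dim\<close> depends only on the
  span. A basis \<open>D\<close> of the intersection is extended to bases \<open>B\<close> of
  \<open>S\<close> and \<open>C\<close> of \<open>T\<close>; then \<open>B \<union> (C - D)\<close>
  is a basis of the sum.\<close>

lemma dim_Un_Int:
  assumes S: "subspace S" "finite_dim S" and T: "subspace T" "finite_dim T"
  shows "dim (S \<union> T) + dim (S \<inter> T) = dim S + dim T"
proof -
  have "finite_dim (S \<inter> T)" using S(2) by (rule finite_dim_subset) simp
  then obtain D where D: "D \<subseteq> S \<inter> T" "finite D" "independent D" "S \<inter> T \<subseteq> span D"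
      "card D = dim (S \<inter> T)"
    using finite_dim_basis by metis
  obtain B where B: "D \<subseteq> B" "B \<subseteq> S" "finite B" "independent B" "S \<subseteq> span B" "card B = dim S"
    using finite_dim_basis_extend[OF S(2) D(3)] D(1) by auto
  obtain C where C: "D \<subseteq> C" "C \<subseteq> T" "finite C" "independent C" "T \<subseteq> span C" "card C = dim T"
    using finite_dim_basis_extend[OF T(2) D(3)] D(1) by auto
  have "independent (B \<union> X) \<and> B \<inter> X = {}" if "finite X" "X \<subseteq> C - D" for X
    using that
  proof (induction X rule: finite_induct)
    case (insert c X)
    \<comment> \<open>In a relation \<open>c = s + x\<close> the part \<open>s\<close> would lie in
      both \<open>S\<close> and \<open>T\<close>, hence in \<open>span D\<close>, and
      \<open>c\<close> would depend on the other vectors of \<open>C\<close>.\<close>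
    have "c \<notin> span (B \<union> X)"
    proof
      assume "c \<in> span (B \<union> X)"
      then obtain s x where sx: "c = s + x" "s \<in> span B" "x \<in> span X"
        unfolding span_Un by blast
      have "s \<in> S" using sx(2) B(2) S(1) span_minimal by blast
      moreover have "x \<in> T" "c \<in> T"
        using sx(3) insert.prems C(2) span_minimal[OF _ T(1), of X] by blast+
      then have "s \<in> T" using sx(1) T(1) subspace_diff[of T c x] by simp
      ultimately have "s \<in> span (D \<union> X)" "x \<in> span (D \<union> X)"
        using D(4) sx(3) span_mono[of D "D \<union> X"] span_mono[of X "D \<union> X"] by blast+
      then have "c \<in> span (D \<union> X)" using sx(1) span_add by simp
      moreover have "D \<union> X \<subseteq> C - {c}" using C(1) insert by blast
      ultimately have "c \<in> span (C - {c})" using span_mono by blast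
      then show False using C(4) insert.prems unfolding dependent_def by blast
    qed
    then show ?case
      using insert independent_insertI[of c "B \<union> X"] span_base[of c "B \<union> X"] by auto
  qed (use B in simp)
  then have BC: "independent (B \<union> (C - D))" "B \<inter> (C - D) = {}" using C(3) by blast+
  have "S \<union> T \<subseteq> span (B \<union> (C - D))"
    using B(1,5) C(5) span_mono[of B "B \<union> (C - D)"] span_mono[of C "B \<union> (C - D)"] by blast
  then have "card (B \<union> (C - D)) = dim (S \<union> T)"
    using BC(1) B(2) C(2) by (intro basis_card_eq_dim) auto
  moreover have "card (B \<union> (C - D)) = card B + (card C - card D)"
    using BC(2) B(3) C D(2) by (simp add: card_Un_disjoint card_Diff_subset)
  moreover have "card D \<le> card C" using C(1,3) by (rule card_mono[rotated])
  ultimately show ?thesis using B C D by simp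
qed

lemma dim_injective_image:
  assumes "module_hom scale scale f" "inj f"
  shows "dim (f ` V) = dim V"
proof -
  interpret f: module_hom scale scale f by fact
  obtain B where B: "B \<subseteq> V" "independent B" "V \<subseteq> span B" "card B = dim V"
    using basis_exists by metis
  have "card (f ` B) = dim (f ` V)"
    using B f.independent_injective_image[of B] assms(2) f.spans_image[of V B]
    by (intro basis_card_eq_dim) (auto intro: inj_on_subset)
  then show ?thesis
    using B(4) card_image[of f B] assms(2) by (simp add: inj_on_subset)
qed

lemma finite_dim_image:
  assumes "module_hom scale scale f" "finite_dim V"
  shows "finite_dim (f ` V)"
proof -
  interpret f: module_hom scale scale f by fact
  show ?thesis using assms(2) f.spans_image unfolding finite_dim_def by blast
qed

section \<open>Hyperplanes, dual bases and transversals\<close>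

lemma dim_Int_hyperplanes:
  assumes B: "subspace B" "finite_dim B"
    and V: "\<And>i. i \<in> I \<Longrightarrow> subspace (V i) \<and> V i \<subseteq> B \<and> Suc (dim (V i)) = dim B"
    and J: "finite J" "J \<subseteq> I"
  shows "dim B \<le> dim (B \<inter> \<Inter>(V ` J)) + card J"
  using J
proof (induction J rule: finite_induct)
  case (insert j J)
  let ?F = "B \<inter> \<Inter>(V ` J)"
  have Vj: "subspace (V j)" "V j \<subseteq> B" "Suc (dim (V j)) = dim B"
    using V insert.prems by auto
  have F: "subspace ?F" using B V insert.prems by (intro subspace_inter subspace_Inter) auto
  \<comment> \<open>The sum of \<open>V j\<close> and \<open>?F\<close> stays inside
    \<open>B\<close>, so intersecting with one more hyperplane costs at most one dimension.\<close>
  have "dim (V j \<union> ?F) \<le> dim B" using B Vj by (intro dim_subset_finite) auto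
  moreover have "dim (V j \<union> ?F) + dim (V j \<inter> ?F) = dim (V j) + dim ?F"
    using dim_Un_Int[OF Vj(1) _ F] B(2) Vj(2) finite_dim_subset by blast
  moreover have "B \<inter> \<Inter>(V ` insert j J) = V j \<inter> ?F" using Vj by auto
  ultimately show ?case using insert Vj(3) by simp
qed simp

text \<open>The equations of the \<open>V i\<close> form a basis of the dual space of
  \<open>B\<close>. Up to scalars, \<open>b\<close> is the basis dual to it: \<open>b i\<close>
  spans the intersection of the hyperplanes other than \<open>V i\<close>.\<close>

lemma dual_basis_of_hyperplanes:
  assumes B: "subspace B" "finite_dim B"
    and I: "finite I" "card I = dim B"
    and V: "\<And>i. i \<in> I \<Longrightarrow> subspace (V i) \<and> V i \<subseteq> B \<and> Suc (dim (V i)) = dim B"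
    and zero: "dim (B \<inter> \<Inter>(V ` I)) = 0"
  shows "\<exists>b. inj_on b I \<and> independent (b ` I) \<and> span (b ` I) = B \<and>
           (\<forall>i\<in>I. V i = span (b ` (I - {i})))"
proof -
  let ?F = "\<lambda>J. B \<inter> \<Inter>(V ` J)"
  have "\<exists>x. x \<in> ?F (I - {i}) \<and> x \<noteq> 0" if "i \<in> I" for i
  proof -
    \<comment> \<open>Only \<open>dim B - 1\<close> hyperplanes are intersected here, so a nonzero
      vector is left over.\<close>
    have "dim B \<le> dim (?F (I - {i})) + card (I - {i})"
      using B V I(1) by (intro dim_Int_hyperplanes[where I = I]) auto
    then have "dim (?F (I - {i})) \<noteq> 0"
      using I that by (metis add_0 card_Diff1_less not_le)
    then have "\<not> ?F (I - {i}) \<subseteq> {0}"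
      using dim_mono_finite[OF finite_dim_finite, of "{0}" "?F (I - {i})"] span_superset[of "{0}"]
      by auto
    then show ?thesis by blast
  qed
  then obtain b where b: "\<And>i. i \<in> I \<Longrightarrow> b i \<in> ?F (I - {i}) \<and> b i \<noteq> 0" by metis
  have notin: "b i \<notin> V i" if "i \<in> I" for i
  proof
    assume "b i \<in> V i"
    then have "b i \<in> ?F I" using b[OF that] by auto
    moreover have "finite_dim (?F I)" using B(2) by (rule finite_dim_subset) simp
    ultimately show False using dim_pos b[OF that] zero by fastforce
  qed
  have sub: "span (b ` (I - {i})) \<subseteq> V i" if "i \<in> I" for i
    using b V that by (intro span_minimal) fastforce+
  have inj: "inj_on b I"
    using b notin by (fastforce simp: inj_on_def)
  have indep: "independent (b ` I)"
    unfolding dependent_def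
  proof
    assume "\<exists>a\<in>b ` I. a \<in> span (b ` I - {a})"
    then obtain i where i: "i \<in> I" "b i \<in> span (b ` I - {b i})" by blast
    have "b ` I - {b i} = b ` (I - {i})" using inj i(1) by (auto simp: inj_on_def)
    then show False using i sub notin by fastforce
  qed
  have dim_b: "dim (span (b ` J)) = card J" if "J \<subseteq> I" for J
    using independent_mono[OF indep, of "b ` J"] that inj
    by (simp add: dim_eq_card_independent image_mono card_image inj_on_subset)
  have "span (b ` I) = B"
  proof (rule subspace_dim_eq[OF B(2)])
    show "span (b ` I) \<subseteq> B" using B(1) b by (intro span_minimal) auto
  qed (use I(2) dim_b[of I] in auto)
  moreover have "V i = span (b ` (I - {i}))" if "i \<in> I" for i
  proof (rule sym, rule subspace_dim_eq)
    show "finite_dim (V i)" using V[OF that] B(2) finite_dim_subset by blast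
    show "dim (V i) \<le> dim (span (b ` (I - {i})))"
      using V[OF that] I that by (subst dim_b) auto
  qed (use sub that in auto)
  ultimately show ?thesis using inj indep by blast
qed

text \<open>
  Rado's theorem on independent transversals, dualised. As in Rado's own proof, the subspaces are
  enlarged one dimension at a time until they are hyperplanes: if neither of two different
  enlargements of \<open>V i\<close> kept the dimension condition, submodularity of \<open>dim\<close> would contradict the
  condition for \<open>V\<close> itself.
\<close>

lemma dual_transversal_basis:
  assumes B: "subspace B" "finite_dim B"
    and I: "finite I" "card I = dim B"
    and V: "\<And>i. i \<in> I \<Longrightarrow> subspace (V i) \<and> V i \<subseteq> B"
    and cond: "\<And>J. J \<subseteq> I \<Longrightarrow> dim (B \<inter> \<Inter>(V ` J)) + card J \<le> dim B"
  shows "\<exists>b. inj_on b I \<and> independent (b ` I) \<and> span (b ` I) = B \<and>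
           (\<forall>i\<in>I. V i \<subseteq> span (b ` (I - {i})))"
  using V cond
\<comment> \<open>The measure is the total codimension in \<open>B\<close>. It is least when all
  \<open>V i\<close> are hyperplanes, since the condition for \<open>{i}\<close> excludes
  \<open>V i = B\<close>.\<close>
proof (induction "\<Sum>i\<in>I. dim B - dim (V i)" arbitrary: V rule: less_induct)
  case less
  note V = less.prems(1) and cond = less.prems(2)
  have BV: "B \<inter> V i = V i" if "i \<in> I" for i using V[OF that] by blast
  have le: "Suc (dim (V i)) \<le> dim B" if "i \<in> I" for i
    using cond[of "{i}"] that BV by simp
  show ?case
  proof (cases "\<forall>i\<in>I. Suc (dim (V i)) = dim B")
    case True
    have "dim (B \<inter> \<Inter>(V ` I)) = 0" using cond[of I] I by simp
    then obtain b where "inj_on b I" "independent (b ` I)" "span (b ` I) = B"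
        "\<forall>i\<in>I. V i = span (b ` (I - {i}))"
      using dual_basis_of_hyperplanes[OF B I, of V] True V by auto
    then show ?thesis by blast
  next
    case False
    then obtain i where i: "i \<in> I" "Suc (dim (V i)) < dim B" using le by fastforce
    have Vi: "subspace (V i)" "V i \<subseteq> B" "finite_dim (V i)"
      using V[OF i(1)] B(2) finite_dim_subset by blast+
    have ext: "\<exists>x. x \<in> B \<and> x \<notin> span X" if "X \<subseteq> B" "dim X < dim B" for X
      using that dim_mono_finite[of X B] finite_dim_subset[OF B(2)] by (metis not_le subsetI)
    obtain w where w: "w \<in> B" "w \<notin> span (V i)" using ext[of "V i"] Vi i(2) by auto
    have dw: "dim (insert w (V i)) = Suc (dim (V i))" using dim_insert_finite Vi(3) w(2) by simp
    obtain w' where w': "w' \<in> B" "w' \<notin> span (insert w (V i))"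
      using ext[of "insert w (V i)"] Vi w(1) i(2) dw by auto
    define W where "W = span (insert w (V i))"
    define W' where "W' = span (insert w' (V i))"
    have fin: "finite_dim (insert x (V i))" for x
      using Vi(3) finite_dim_finite[of "{x}"] finite_dim_Un[of "{x}" "V i"] by simp
    have W: "subspace W" "W \<subseteq> B" "V i \<subseteq> W" "finite_dim W" "dim W = Suc (dim (V i))"
      unfolding W_def using span_minimal[of "insert w (V i)" B] span_superset[of "insert w (V i)"]
        B(1) w(1) Vi(2) dw fin by auto
    have "w' \<notin> span (V i)" using w'(2) span_mono[of "V i" "insert w (V i)"] by blast
    then have W': "subspace W'" "W' \<subseteq> B" "V i \<subseteq> W'" "finite_dim W'" "dim W' = Suc (dim (V i))"
      unfolding W'_def using span_minimal[of "insert w' (V i)" B] span_superset[of "insert w' (V i)"]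
        B(1) w'(1) Vi(2,3) fin by (auto simp: dim_insert_finite)
    \<comment> \<open>As \<open>w'\<close> is outside \<open>W\<close>, the sum of \<open>W\<close>
      and \<open>W'\<close> has dimension at least \<open>dim (V i) + 2\<close>.\<close>
    have WW': "W \<inter> W' = V i"
    proof -
      have "dim (insert w' W) = Suc (dim W)"
        using w'(2) W(1,4) by (simp add: dim_insert_finite W_def span_span)
      moreover have "dim (insert w' W) \<le> dim (W \<union> W')"
        using W W' span_base[of w' "insert w' (V i)"]
        by (intro dim_subset_finite) (auto simp: W'_def)
      ultimately have "dim (W \<inter> W') \<le> dim (V i)"
        using dim_Un_Int[OF W(1,4) W'(1,4)] W(5) W'(5) by simp
      then show ?thesis
        using subspace_dim_eq[of "W \<inter> W'" "V i"] Vi W W' finite_dim_subset[OF W(4)] by auto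
    qed
    let ?F = "\<lambda>J. B \<inter> \<Inter>(V ` J)"
    define good where "good U \<longleftrightarrow> (\<forall>J\<subseteq>I. dim (B \<inter> \<Inter>((V(i := U)) ` J)) + card J \<le> dim B)" for U
    \<comment> \<open>A violation must use the index \<open>i\<close>, where alone the family has
      changed. \<open>K\<close> is the violating index set without \<open>i\<close>, which turns the
      strict inequality into a weak one.\<close>
    have bad: "\<exists>K\<subseteq>I - {i}. dim B \<le> dim (U \<inter> ?F K) + card K" if "\<not> good U" for U
    proof -
      have "\<exists>J. J \<subseteq> I \<and> dim B < dim (B \<inter> \<Inter>((V(i := U)) ` J)) + card J"
        using that unfolding good_def not_all not_imp not_le .
      then obtain J where J: "J \<subseteq> I" "dim B < dim (B \<inter> \<Inter>((V(i := U)) ` J)) + card J"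
        by (elim exE conjE)
      have "i \<in> J"
      proof (rule ccontr)
        assume "i \<notin> J"
        then have "(V(i := U)) ` J = V ` J" by auto
        then show False using J cond[of J] by simp
      qed
      then have "B \<inter> \<Inter>((V(i := U)) ` J) = U \<inter> ?F (J - {i})" by auto
      moreover have "card J = Suc (card (J - {i}))"
        using \<open>i \<in> J\<close> J(1) I(1) by (meson card.remove finite_subset)
      ultimately show ?thesis
        using J by (intro exI[of _ "J - {i}"]) auto
    qed
    have "good W \<or> good W'"
    proof (rule ccontr)
      assume "\<not> (good W \<or> good W')"
      then obtain K K' where K: "K \<subseteq> I - {i}" "dim B \<le> dim (W \<inter> ?F K) + card K"
        and K': "K' \<subseteq> I - {i}" "dim B \<le> dim (W' \<inter> ?F K') + card K'"
        using bad by metis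
      have sub: "subspace (?F J)" if "J \<subseteq> I" for J
        using that B V by (intro subspace_inter subspace_Inter) auto
      have "subspace (W \<inter> ?F K)" "subspace (W' \<inter> ?F K')"
        using K(1) K'(1) by (blast intro!: subspace_inter[of _ "?F _"] W(1) W'(1) sub)+
      then have "dim ((W \<inter> ?F K) \<union> (W' \<inter> ?F K')) + dim ((W \<inter> ?F K) \<inter> (W' \<inter> ?F K'))
          = dim (W \<inter> ?F K) + dim (W' \<inter> ?F K')"
        using finite_dim_subset[OF W(4)] finite_dim_subset[OF W'(4)] by (intro dim_Un_Int) auto
      \<comment> \<open>Since \<open>W \<inter> W' = V i\<close>, the intersection is the one for
        the index set \<open>insert i (K \<union> K')\<close>. The union lies in the one for
        \<open>K \<inter> K'\<close>. The conditions for these two sets leave a deficit of one,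
        caused by the index \<open>i\<close>.\<close>
      moreover have "dim ((W \<inter> ?F K) \<inter> (W' \<inter> ?F K')) = dim (?F (insert i (K \<union> K')))"
        using WW' by (intro arg_cong[of _ _ dim]) auto
      moreover have "dim ((W \<inter> ?F K) \<union> (W' \<inter> ?F K')) \<le> dim (?F (K \<inter> K'))"
        using finite_dim_subset[OF B(2)] by (intro dim_subset_finite) auto
      moreover have "dim (?F (K \<inter> K')) + card (K \<inter> K') \<le> dim B"
        using K(1) by (intro cond) auto
      moreover have "dim (?F (insert i (K \<union> K'))) + card (insert i (K \<union> K')) \<le> dim B"
        using K(1) K'(1) i(1) by (intro cond) auto
      moreover have "finite K" "finite K'" using K(1) K'(1) I(1) finite_subset by blast+
      then have "card (insert i (K \<union> K')) = Suc (card (K \<union> K'))"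
          "card (K \<union> K') + card (K \<inter> K') = card K + card K'"
        using K(1) K'(1) by (auto simp: card_insert_if card_Un_Int[symmetric])
      ultimately show False using K(2) K'(2) by linarith
    qed
    then obtain U where U: "good U" "subspace U" "U \<subseteq> B" "V i \<subseteq> U" "dim U = Suc (dim (V i))"
      using W W' by blast
    have VU: "subspace ((V(i := U)) j) \<and> (V(i := U)) j \<subseteq> B" if "j \<in> I" for j
      using U(2,3) V[OF that] by simp
    have "(\<Sum>j\<in>I. dim B - dim ((V(i := U)) j)) < (\<Sum>j\<in>I. dim B - dim (V j))"
      using i U(5) I(1) by (intro sum_strict_mono_ex1) auto
    from less.hyps[OF this VU U(1)[unfolded good_def, rule_format]]
    obtain b where b: "inj_on b I" "independent (b ` I)" "span (b ` I) = B"
        "\<forall>j\<in>I. (V(i := U)) j \<subseteq> span (b ` (I - {j}))"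
      by blast
    have "V j \<subseteq> span (b ` (I - {j}))" if "j \<in> I" for j
      using b(4)[rule_format, OF that] U(4) by (cases "j = i") auto
    then show ?thesis using b by blast
  qed
qed

end

section \<open>Multiplication in \<open>L\<close> as a family of linear maps over
  \<open>K\<close>\<close>

context central_extension
begin

lemma finite_dim_subspace_iff: "finite_dim_subspace V \<longleftrightarrow> K.subspace V \<and> K.finite_dim V"
proof
  assume V: "K.subspace V \<and> K.finite_dim V"
  then obtain S where "S \<subseteq> V" "finite S" "V \<subseteq> K.span S"
    using K.finite_dim_basis by metis
  then have "K.span S = V" using V by (simp add: K.span_subspace)
  then show "finite_dim_subspace V" using V \<open>finite S\<close> unfolding finite_dim_subspace_def by blast
qed (use K.span_superset in \<open>auto simp: finite_dim_subspace_def K.finite_dim_def\<close>)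

lemma range_emb: "range emb = K.span {1}"
  by (simp add: K.span_singleton scale_def)

text \<open>Scalars act from the left and have to pass \<open>a\<close>, which uses centrality;
  right multiplication needs associativity only.\<close>

lemma module_hom_mult_left: "module_hom scale scale (\<lambda>x. a * x)"
proof unfold_locales
  fix c x
  show "a * scale c x = scale c (a * x)"
    unfolding scale_def by (metis emb_central mult.assoc)
qed (simp add: distrib_left)

lemma module_hom_mult_right: "module_hom scale scale (\<lambda>x. x * a)"
  by unfold_locales (simp_all add: scale_def distrib_right mult.assoc)

lemmas subspace_mult_left = module_hom.subspace_image[OF module_hom_mult_left]
  and subspace_mult_right = module_hom.subspace_image[OF module_hom_mult_right]
  and subspace_vimage_mult_left = module_hom.subspace_vimage[OF module_hom_mult_left]
  and subspace_vimage_mult_right = module_hom.subspace_vimage[OF module_hom_mult_right]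
  and finite_dim_mult_left = K.finite_dim_image[OF module_hom_mult_left]
  and finite_dim_mult_right = K.finite_dim_image[OF module_hom_mult_right]

lemma dim_mult_left: "a \<noteq> 0 \<Longrightarrow> K.dim ((\<lambda>x. a * x) ` V) = K.dim V"
  by (rule K.dim_injective_image[OF module_hom_mult_left]) (simp add: inj_on_def)

lemma dim_mult_right: "a \<noteq> 0 \<Longrightarrow> K.dim ((\<lambda>x. x * a) ` V) = K.dim V"
  by (rule K.dim_injective_image[OF module_hom_mult_right]) (simp add: inj_on_def)

text \<open>Right multiplication by \<open>x\<close> maps \<open>{a \<in> A. a * x \<in> A}\<close>
  onto the intersection of \<open>A\<close> with \<open>A x\<close>, so the formula for sum and
  intersection applies.\<close>

lemma dim_translate_right:
  assumes "K.subspace A" "K.finite_dim A" "x \<noteq> 0"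
  shows "K.dim (K.span (A \<union> (\<lambda>a. a * x) ` A)) + K.dim {a \<in> A. a * x \<in> A} = 2 * K.dim A"
proof -
  have "A \<inter> (\<lambda>a. a * x) ` A = (\<lambda>a. a * x) ` {a \<in> A. a * x \<in> A}" by blast
  then show ?thesis
    using K.dim_Un_Int[OF assms(1,2) subspace_mult_right[OF assms(1)]
        finite_dim_mult_right[OF assms(2)], of x] assms(3)
    by (simp add: dim_mult_right)
qed

lemma dim_translate_left:
  assumes "K.subspace B" "K.finite_dim B" "x \<noteq> 0"
  shows "K.dim (K.span (B \<union> (\<lambda>b. x * b) ` B)) + K.dim {b \<in> B. x * b \<in> B} = 2 * K.dim B"
proof -
  have "B \<inter> (\<lambda>b. x * b) ` B = (\<lambda>b. x * b) ` {b \<in> B. x * b \<in> B}" by blast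
  then show ?thesis
    using K.dim_Un_Int[OF assms(1,2) subspace_mult_left[OF assms(1)]
        finite_dim_mult_left[OF assms(2)], of x] assms(3)
    by (simp add: dim_mult_left)
qed

section \<open>Pairs of subspaces with product in a fixed subspace\<close>

definition factor_pair :: "'l set \<Rightarrow> 'l set \<Rightarrow> 'l set \<Rightarrow> bool"
  where "factor_pair C A B \<longleftrightarrow> K.subspace A \<and> K.subspace B \<and> A \<noteq> {0} \<and> B \<noteq> {0} \<and>
    (\<forall>a\<in>A. \<forall>b\<in>B. a * b \<in> C)"

lemma subspace_nonzero: "K.subspace A \<Longrightarrow> A \<noteq> {0} \<Longrightarrow> \<exists>a\<in>A. a \<noteq> 0"
  using K.subspace_0 by auto

text \<open>Right multiplication by a nonzero \<open>b \<in> B\<close> embeds \<open>A\<close> into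
  \<open>C\<close>; for this reason \<open>factor_pair\<close> excludes zero factors.\<close>

lemma factor_pair_left_bound:
  assumes C: "K.finite_dim C" and AB: "factor_pair C A B"
  shows "K.finite_dim A" "K.dim A \<le> K.dim C"
proof -
  obtain b where b: "b \<in> B" "b \<noteq> 0" using AB subspace_nonzero unfolding factor_pair_def by metis
  have sub: "(\<lambda>a. a * b) ` A \<subseteq> C" using AB b unfolding factor_pair_def by blast
  then show "K.dim A \<le> K.dim C"
    using K.dim_subset_finite[OF C sub] dim_mult_right[OF b(2)] by simp
  have "(\<lambda>a. a * inverse b) ` (\<lambda>a. a * b) ` A = A" using b(2) by (simp add: image_image mult.assoc)
  then show "K.finite_dim A"
    using finite_dim_mult_right[OF K.finite_dim_subset[OF C sub], of "inverse b"] by simp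
qed

lemma factor_pair_right_bound:
  assumes C: "K.finite_dim C" and AB: "factor_pair C A B"
  shows "K.finite_dim B" "K.dim B \<le> K.dim C"
proof -
  obtain a where a: "a \<in> A" "a \<noteq> 0" using AB subspace_nonzero unfolding factor_pair_def by metis
  have sub: "(\<lambda>b. a * b) ` B \<subseteq> C" using AB a unfolding factor_pair_def by blast
  then show "K.dim B \<le> K.dim C"
    using K.dim_subset_finite[OF C sub] dim_mult_left[OF a(2)] by simp
  have "(\<lambda>b. inverse a * b) ` (\<lambda>b. a * b) ` B = B"
    using a(2) by (simp add: image_image mult.assoc[symmetric])
  then show "K.finite_dim B"
    using finite_dim_mult_left[OF K.finite_dim_subset[OF C sub], of "inverse a"] by simp
qed

text \<open>If \<open>b\<close> and \<open>x * b\<close> both lie in \<open>B\<close>, then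
  \<open>(a * x) * b = a * (x * b)\<close> is again in \<open>C\<close>. The second member can
  shrink to zero, hence the assumption \<open>nz\<close>.\<close>

lemma factor_pair_transform_right:
  assumes C: "K.subspace C" and AB: "factor_pair C A B" and nz: "{b \<in> B. x * b \<in> B} \<noteq> {0}"
  shows "factor_pair C (K.span (A \<union> (\<lambda>a. a * x) ` A)) {b \<in> B. x * b \<in> B}"
proof -
  have "K.subspace (B \<inter> (\<lambda>b. x * b) -` B)"
    using AB unfolding factor_pair_def by (intro K.subspace_inter subspace_vimage_mult_left) auto
  moreover have "B \<inter> (\<lambda>b. x * b) -` B = {b \<in> B. x * b \<in> B}" by blast
  moreover have "K.span (A \<union> (\<lambda>a. a * x) ` A) \<noteq> {0}"
    using AB K.span_superset[of "A \<union> (\<lambda>a. a * x) ` A"] subspace_nonzero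
    unfolding factor_pair_def by blast
  moreover have "K.span (A \<union> (\<lambda>a. a * x) ` A) \<subseteq> (\<lambda>a. a * b) -` C" if "b \<in> B" "x * b \<in> B" for b
    using that AB C unfolding factor_pair_def
    by (intro K.span_minimal subspace_vimage_mult_right) (auto simp: mult.assoc)
  ultimately show ?thesis using nz unfolding factor_pair_def by auto
qed

lemma factor_pair_transform_left:
  assumes C: "K.subspace C" and AB: "factor_pair C A B" and nz: "{a \<in> A. a * x \<in> A} \<noteq> {0}"
  shows "factor_pair C {a \<in> A. a * x \<in> A} (K.span (B \<union> (\<lambda>b. x * b) ` B))"
proof -
  have "K.subspace (A \<inter> (\<lambda>a. a * x) -` A)"
    using AB unfolding factor_pair_def by (intro K.subspace_inter subspace_vimage_mult_right) auto
  moreover have "A \<inter> (\<lambda>a. a * x) -` A = {a \<in> A. a * x \<in> A}" by blast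
  moreover have "K.span (B \<union> (\<lambda>b. x * b) ` B) \<noteq> {0}"
    using AB K.span_superset[of "B \<union> (\<lambda>b. x * b) ` B"] subspace_nonzero
    unfolding factor_pair_def by blast
  moreover have "K.span (B \<union> (\<lambda>b. x * b) ` B) \<subseteq> (\<lambda>b. a * b) -` C" if "a \<in> A" "a * x \<in> A" for a
    using that AB C unfolding factor_pair_def
    by (intro K.span_minimal subspace_vimage_mult_left) (auto simp: mult.assoc[symmetric])
  ultimately show ?thesis using nz unfolding factor_pair_def by auto
qed

text \<open>By \<open>stable\<close>, a single nonzero \<open>a \<in> A\<close> with
  \<open>a * x \<in> A\<close> forces \<open>A x \<subseteq> A\<close>. Hence the translate consists
  of all right multipliers of \<open>A\<close>, and these are closed under the field
  operations.\<close>

lemma intermediate_field_right_stable: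
  assumes A: "K.subspace A"
    and stable: "\<And>a b x. \<lbrakk>a \<in> A; a \<noteq> 0; a * x \<in> A; x \<noteq> 0; b \<in> A\<rbrakk> \<Longrightarrow> b * x \<in> A"
    and a0: "a0 \<in> A" "a0 \<noteq> 0"
  shows "intermediate_field ((\<lambda>a. inverse a0 * a) ` A)" (is "intermediate_field ?M")
proof -
  have M: "y \<in> ?M \<longleftrightarrow> a0 * y \<in> A" for y
  proof
    assume "a0 * y \<in> A"
    moreover have "y = inverse a0 * (a0 * y)" using a0(2) by (simp add: mult.assoc[symmetric])
    ultimately show "y \<in> ?M" by blast
  qed (use a0 in \<open>auto simp: mult.assoc[symmetric]\<close>)
  have "a0 * emb c \<in> A" for c
    using K.subspace_scale[OF A a0(1), of c] emb_central[of c a0] by (simp add: scale_def)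
  moreover have "a0 * (x - y) \<in> A" if "a0 * x \<in> A" "a0 * y \<in> A" for x y
    using K.subspace_diff[OF A that] by (simp add: right_diff_distrib)
  moreover have "a0 * (x * y) \<in> A" if "a0 * x \<in> A" "a0 * y \<in> A" for x y
    using stable[OF a0 that(2) _ that(1)] K.subspace_0[OF A]
    by (cases "y = 0") (simp_all add: mult.assoc)
  \<comment> \<open>The test element is now \<open>a0 * x\<close>, which \<open>inverse x\<close>
    carries back to \<open>a0\<close>.\<close>
  moreover have "a0 * inverse x \<in> A" if "a0 * x \<in> A" for x
    using stable[OF that, of "inverse x" a0] a0 K.subspace_0[OF A]
    by (cases "x = 0") (simp_all add: mult.assoc)
  ultimately show ?thesis unfolding intermediate_field_def using M by auto
qed

lemma intermediate_field_left_stable: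
  assumes B: "K.subspace B"
    and stable: "\<And>a b x. \<lbrakk>a \<in> B; a \<noteq> 0; x * a \<in> B; x \<noteq> 0; b \<in> B\<rbrakk> \<Longrightarrow> x * b \<in> B"
    and b0: "b0 \<in> B" "b0 \<noteq> 0"
  shows "intermediate_field ((\<lambda>b. b * inverse b0) ` B)" (is "intermediate_field ?M")
proof -
  have M: "y \<in> ?M \<longleftrightarrow> y * b0 \<in> B" for y
  proof
    assume "y * b0 \<in> B"
    moreover have "y = y * b0 * inverse b0" using b0(2) by (simp add: mult.assoc)
    ultimately show "y \<in> ?M" by blast
  qed (use b0 in \<open>auto simp: mult.assoc\<close>)
  have "emb c * b0 \<in> B" for c
    using K.subspace_scale[OF B b0(1), of c] by (simp add: scale_def)
  moreover have "(x - y) * b0 \<in> B" if "x * b0 \<in> B" "y * b0 \<in> B" for x y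
    using K.subspace_diff[OF B that] by (simp add: left_diff_distrib)
  moreover have "x * y * b0 \<in> B" if "x * b0 \<in> B" "y * b0 \<in> B" for x y
    using stable[OF b0 that(1) _ that(2)] K.subspace_0[OF B]
    by (cases "x = 0") (simp_all add: mult.assoc)
  moreover have "inverse x * b0 \<in> B" if "x * b0 \<in> B" for x
    using stable[OF that, of "inverse x" b0] b0 K.subspace_0[OF B]
    by (cases "x = 0") (simp_all add: mult.assoc[symmetric])
  ultimately show ?thesis unfolding intermediate_field_def using M by auto
qed

text \<open>
  Among the pairs violating the bound take one with \<open>dim X + dim Y\<close> greatest and, subject to that,
  \<open>min (dim X) (dim Y)\<close> least. The two Kemperman transforms by \<open>x\<close> have average total
  \<open>dim X + dim Y\<close>, so unless \<open>X x = X\<close> one of them contradicts the choice. The choice of the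
  smaller of \<open>X\<close> and \<open>Y\<close> covers the case in which only one of the two transforms is nonzero.
\<close>

lemma dim_factor_pair:
  assumes no_field: "\<And>M. \<lbrakk>intermediate_field M; K.finite_dim M\<rbrakk> \<Longrightarrow> M = range emb \<or> M = UNIV"
    and C: "K.subspace C" "K.finite_dim C" "C \<noteq> UNIV"
    and AB: "factor_pair C A B"
  shows "K.dim A + K.dim B \<le> Suc (K.dim C)"
proof (rule ccontr)
  assume large: "\<not> ?thesis"
  define total where "total p = K.dim (fst p) + K.dim (snd p)" for p :: "'l set \<times> 'l set"
  define smaller where "smaller p = min (K.dim (fst p)) (K.dim (snd p))" for p :: "'l set \<times> 'l set"
  define pair where "pair p \<longleftrightarrow> factor_pair C (fst p) (snd p)" for p
  have "pair (A, B)" using AB by (simp add: pair_def)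
  \<comment> \<open>Both members embed into \<open>C\<close>, so the totals are bounded and a
    greatest one exists.\<close>
  moreover have "\<forall>p. pair p \<longrightarrow> total p < Suc (2 * K.dim C)"
    using factor_pair_left_bound(2)[OF C(2)] factor_pair_right_bound(2)[OF C(2)]
    unfolding pair_def total_def by (metis add_mono less_Suc_eq_le mult_2)
  ultimately obtain p0 where p0: "pair p0" "\<forall>p. pair p \<longrightarrow> total p \<le> total p0"
    using ex_has_greatest_nat[of pair "(A, B)" total] by blast
  then obtain p where p: "pair p" "total p = total p0"
      "\<forall>q. pair q \<and> total q = total p0 \<longrightarrow> smaller p \<le> smaller q"
    using ex_has_least_nat[of "\<lambda>q. pair q \<and> total q = total p0" p0 smaller] by blast
  obtain X Y where XY: "p = (X, Y)" by fastforce
  have pXY: "factor_pair C X Y" using p(1) XY by (simp add: pair_def)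
  have greatest: "K.dim X' + K.dim Y' \<le> K.dim X + K.dim Y" if "factor_pair C X' Y'" for X' Y'
    using p0(2)[rule_format, of "(X', Y')"] that p(2) XY by (simp add: pair_def total_def)
  have least: "min (K.dim X) (K.dim Y) \<le> min (K.dim X') (K.dim Y')"
    if "factor_pair C X' Y'" "K.dim X' + K.dim Y' = K.dim X + K.dim Y" for X' Y'
    using p(2) p(3)[rule_format, of "(X', Y')"] that XY
    by (simp add: pair_def total_def smaller_def)
  have sub: "K.subspace X" "K.subspace Y" using pXY by (auto simp: factor_pair_def)
  have fin: "K.finite_dim X" "K.finite_dim Y"
    using factor_pair_left_bound(1) factor_pair_right_bound(1) C(2) pXY by blast+
  have "K.dim X + K.dim Y > Suc (K.dim C)" using greatest[OF AB] large by simp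
  \<comment> \<open>Each dimension is at most \<open>dim C\<close>, while the sum is at least
    \<open>dim C + 2\<close>. The field constructed below is therefore larger than
    \<open>K\<close>.\<close>
  then have dim2: "K.dim X \<ge> 2" "K.dim Y \<ge> 2"
    using factor_pair_left_bound(2)[OF C(2) pXY] factor_pair_right_bound(2)[OF C(2) pXY]
    by linarith+
  have dims: "K.dim (K.span (X \<union> (\<lambda>a. a * x) ` X)) + K.dim {a \<in> X. a * x \<in> X} = 2 * K.dim X"
      "K.dim (K.span (Y \<union> (\<lambda>b. x * b) ` Y)) + K.dim {b \<in> Y. x * b \<in> Y} = 2 * K.dim Y"
    if "x \<noteq> 0" for x
    using dim_translate_right dim_translate_left sub fin that by blast+
  have no_M: False if "intermediate_field M" "K.finite_dim M" "K.dim M \<ge> 2" "M \<noteq> UNIV" for M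
  proof -
    have "K.dim (range emb) \<le> 1"
      using K.dim_le_card[of "range emb" "{1}"] by (simp add: range_emb)
    then have "M \<noteq> range emb" using that(3) by auto
    then show False using no_field[OF that(1,2)] that(4) by blast
  qed
  \<comment> \<open>For nonzero \<open>b \<in> Y\<close>, \<open>X = L\<close> would give
    \<open>X b = L\<close> inside \<open>C\<close>; similarly for \<open>Y\<close>. This keeps the
    field below different from \<open>L\<close>.\<close>
  have proper: "X \<noteq> UNIV" "Y \<noteq> UNIV"
  proof -
    obtain a b where ab: "a \<in> X" "a \<noteq> 0" "b \<in> Y" "b \<noteq> 0"
      using pXY subspace_nonzero unfolding factor_pair_def by metis
    obtain c where c: "c \<notin> C" using C(3) by blast
    have "c * inverse b * b = c" "a * (inverse a * c) = c"
      using ab by (simp_all add: mult.assoc) (simp add: mult.assoc[symmetric])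
    moreover have "x * y \<in> C" if "x \<in> X" "y \<in> Y" for x y
      using pXY that by (simp add: factor_pair_def)
    ultimately have "c * inverse b \<notin> X" "inverse a * c \<notin> Y" using ab c by metis+
    then show "X \<noteq> UNIV" "Y \<noteq> UNIV" by blast+
  qed
  show False
  proof (cases "K.dim X \<le> K.dim Y")
    case True
    have stable: "b * x \<in> X" if H: "a \<in> X" "a \<noteq> 0" "a * x \<in> X" "x \<noteq> 0" "b \<in> X" for a b x
    proof (rule ccontr)
      let ?X' = "K.span (X \<union> (\<lambda>a. a * x) ` X)" and ?X2 = "{a \<in> X. a * x \<in> X}"
      let ?Y' = "K.span (Y \<union> (\<lambda>b. x * b) ` Y)" and ?Y2 = "{b \<in> Y. x * b \<in> Y}"
      assume "b * x \<notin> X"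
      have nz: "?X2 \<noteq> {0}" using H by blast
      then have pair2: "factor_pair C ?X2 ?Y'" by (rule factor_pair_transform_left[OF C(1) pXY])
      then have "K.subspace ?X2" by (simp add: factor_pair_def)
      then have less: "K.dim ?X2 < K.dim X"
        using K.subspace_dim_eq[OF fin(1), of ?X2] H(5) \<open>b * x \<notin> X\<close>
        by (metis (no_types, lifting) mem_Collect_eq not_less subsetI)
      have "K.dim ?X2 > 0"
        using K.dim_pos[of ?X2 a] K.finite_dim_subset[OF fin(1), of ?X2] H by auto
      \<comment> \<open>Otherwise \<open>?Y'\<close> has dimension \<open>2 * dim Y\<close>. As
        \<open>?X2\<close> is nonzero and \<open>dim X \<le> dim Y\<close>, the total of the first
        transform would exceed the greatest one.\<close>
      then have "?Y2 \<noteq> {0}"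
        using greatest[OF pair2] dims(2)[OF H(4)] True by (auto simp del: K.dim_span)
      then have "factor_pair C ?X' ?Y2" by (rule factor_pair_transform_right[OF C(1) pXY])
      \<comment> \<open>The totals of the two transforms add up to twice the greatest total, so each
        attains it. But \<open>?X2\<close> is smaller than \<open>X\<close>, the smaller member of
        the chosen pair.\<close>
      then have "K.dim ?X2 + K.dim ?Y' = K.dim X + K.dim Y"
        using greatest[OF pair2] greatest[of ?X' ?Y2] dims[OF H(4)] by linarith
      then show False using least[OF pair2] less True by linarith
    qed
    obtain a0 where a0: "a0 \<in> X" "a0 \<noteq> 0"
      using pXY subspace_nonzero unfolding factor_pair_def by metis
    let ?M = "(\<lambda>a. inverse a0 * a) ` X"
    have "intermediate_field ?M"
      by (rule intermediate_field_right_stable[OF sub(1) _ a0]) (rule stable)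
    moreover have "K.dim ?M \<ge> 2" using dim2 a0 by (simp add: dim_mult_left)
    moreover have "?M \<noteq> UNIV"
    proof
      assume M: "?M = UNIV"
      have "y \<in> X" for y
      proof -
        have "inverse a0 * y \<in> ?M" using M by blast
        then show "y \<in> X" using a0(2) by auto
      qed
      then show False using proper by blast
    qed
    ultimately show False using no_M finite_dim_mult_left[OF fin(1)] by blast
  next
    case False
    \<comment> \<open>The mirror image: \<open>Y\<close> is now the smaller member, and left
      multipliers give the field.\<close>
    have stable: "x * b \<in> Y" if H: "a \<in> Y" "a \<noteq> 0" "x * a \<in> Y" "x \<noteq> 0" "b \<in> Y" for a b x
    proof (rule ccontr)
      let ?X' = "K.span (X \<union> (\<lambda>a. a * x) ` X)" and ?X2 = "{a \<in> X. a * x \<in> X}"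
      let ?Y' = "K.span (Y \<union> (\<lambda>b. x * b) ` Y)" and ?Y2 = "{b \<in> Y. x * b \<in> Y}"
      assume "x * b \<notin> Y"
      have nz: "?Y2 \<noteq> {0}" using H by blast
      then have pair2: "factor_pair C ?X' ?Y2" by (rule factor_pair_transform_right[OF C(1) pXY])
      then have "K.subspace ?Y2" by (simp add: factor_pair_def)
      then have less: "K.dim ?Y2 < K.dim Y"
        using K.subspace_dim_eq[OF fin(2), of ?Y2] H(5) \<open>x * b \<notin> Y\<close>
        by (metis (no_types, lifting) mem_Collect_eq not_less subsetI)
      have "K.dim ?Y2 > 0"
        using K.dim_pos[of ?Y2 a] K.finite_dim_subset[OF fin(2), of ?Y2] H by auto
      then have "?X2 \<noteq> {0}"
        using greatest[OF pair2] dims(1)[OF H(4)] False by (auto simp del: K.dim_span)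
      then have "factor_pair C ?X2 ?Y'" by (rule factor_pair_transform_left[OF C(1) pXY])
      then have "K.dim ?X' + K.dim ?Y2 = K.dim X + K.dim Y"
        using greatest[OF pair2] greatest[of ?X2 ?Y'] dims[OF H(4)] by linarith
      then show False using least[OF pair2] less False by linarith
    qed
    obtain b0 where b0: "b0 \<in> Y" "b0 \<noteq> 0"
      using pXY subspace_nonzero unfolding factor_pair_def by metis
    let ?M = "(\<lambda>b. b * inverse b0) ` Y"
    have "intermediate_field ?M"
      by (rule intermediate_field_left_stable[OF sub(2) _ b0]) (rule stable)
    moreover have "K.dim ?M \<ge> 2" using dim2 b0 by (simp add: dim_mult_right)
    moreover have "?M \<noteq> UNIV"
    proof
      assume M: "?M = UNIV"
      have "y \<in> Y" for y
      proof -
        have "y * inverse b0 \<in> ?M" using M by blast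
        then show "y \<in> Y" using b0(2) by auto
      qed
      then show False using proper by blast
    qed
    ultimately show False using no_M finite_dim_mult_right[OF fin(2)] by blast
  qed
qed

section \<open>Matching in the absence of proper finite-dimensional intermediate fields\<close>

lemma indexed_basis_dim:
  assumes "indexed_basis n b V" "J \<subseteq> {1..n}"
  shows "K.dim (K.span (b ` J)) = card J"
proof -
  have "K.independent (b ` J)"
    using assms K.independent_mono unfolding indexed_basis_def by (meson image_mono)
  then show ?thesis
    using assms card_image[of b J] inj_on_subset[of b "{1..n}" J] unfolding indexed_basis_def
    by (simp add: K.dim_eq_card_independent)
qed

lemma subspace_matchedI:
  assumes no_field: "\<And>M. \<lbrakk>intermediate_field M; K.finite_dim M\<rbrakk> \<Longrightarrow> M = range emb \<or> M = UNIV"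
    and A: "K.subspace A" "K.finite_dim A" "K.dim A = n"
    and B: "K.subspace B" "K.finite_dim B" "K.dim B = n" "1 \<notin> B"
  shows "subspace_matched n A B"
  unfolding subspace_matched_def
proof (intro allI impI)
  fix a assume a: "indexed_basis n a A"
  \<comment> \<open>\<open>basis_matched\<close> asks exactly that each \<open>V i\<close> lie in
    the span of the \<open>b j\<close> with \<open>j \<noteq> i\<close>.\<close>
  define V where "V i = {x \<in> B. a i * x \<in> A}" for i
  \<comment> \<open>If \<open>A\<close> were all of \<open>L\<close>, then \<open>B\<close>, having
    the same finite dimension, would be \<open>L\<close> too and contain 1.\<close>
  have "A \<noteq> UNIV"
    using K.subspace_dim_eq[OF A(2) B(1)] A(3) B(3,4) by auto
  have V: "K.subspace (V i) \<and> V i \<subseteq> B" for i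
  proof -
    have "V i = B \<inter> (\<lambda>x. a i * x) -` A" unfolding V_def by blast
    then show ?thesis
      using K.subspace_inter[OF B(1) subspace_vimage_mult_left[OF A(1)]] by simp
  qed
  have cond: "K.dim (B \<inter> \<Inter>(V ` J)) + card J \<le> K.dim B" if J: "J \<subseteq> {1..n}" for J
  proof (cases "J = {}")
    case False
    let ?W = "B \<inter> \<Inter>(V ` J)"
    let ?U = "K.span (a ` J)" and ?W' = "K.span (insert 1 ?W)"
    have W: "K.subspace ?W" using V B(1) by (intro K.subspace_inter K.subspace_Inter) auto
    have finW: "K.finite_dim ?W" using B(2) by (rule K.finite_dim_subset) simp
    have "K.span ?W = ?W" using W by simp
    then have "1 \<notin> K.span ?W" using B(4) by blast
    \<comment> \<open>The dimension gained from 1 cancels the \<open>Suc\<close> in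
      \<open>dim_factor_pair\<close>.\<close>
    then have dimW: "K.dim ?W' = Suc (K.dim ?W)" by (simp add: K.dim_insert_finite[OF finW])
    have dimU: "K.dim ?U = card J" by (rule indexed_basis_dim[OF a J])
    have a_in: "a j \<in> A" if "j \<in> J" for j
      using a J that K.span_base[of "a j" "a ` {1..n}"] unfolding indexed_basis_def by auto
    have "factor_pair A ?U ?W'"
      unfolding factor_pair_def
    proof (intro conjI ballI)
      show "?U \<noteq> {0}"
        using dimU False J finite_subset[OF J] by (auto simp del: K.dim_span)
      show "?W' \<noteq> {0}" using dimW by (auto simp del: K.dim_span)
      fix u w assume uw: "u \<in> ?U" "w \<in> ?W'"
      \<comment> \<open>Products are extended from generators in two rounds: over \<open>?U\<close>
        for a fixed generator \<open>w\<close>, then over \<open>?W'\<close> for a fixed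
        \<open>u\<close>.\<close>
      have U_W: "?U \<subseteq> (\<lambda>u. u * w) -` A" if "w \<in> insert 1 ?W" for w
        using that a_in A(1)
        by (intro K.span_minimal subspace_vimage_mult_right) (auto simp: V_def)
      have "?W' \<subseteq> (\<lambda>w. u * w) -` A"
        using U_W uw(1) A(1) by (intro K.span_minimal subspace_vimage_mult_left) blast+
      then show "u * w \<in> A" using uw(2) by blast
    qed auto
    then have "K.dim ?U + K.dim ?W' \<le> Suc (K.dim A)"
      by (intro dim_factor_pair[OF _ A(1,2) \<open>A \<noteq> UNIV\<close>]) (rule no_field)
    then show ?thesis using dimU dimW A(3) B(3) by (simp del: K.dim_span)
  qed simp
  have "\<exists>b. inj_on b {1..n} \<and> K.independent (b ` {1..n}) \<and> K.span (b ` {1..n}) = B \<and>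
      (\<forall>i\<in>{1..n}. V i \<subseteq> K.span (b ` ({1..n} - {i})))"
    by (rule K.dual_transversal_basis) (use B V cond in simp_all)
  then show "\<exists>b. indexed_basis n b B \<and> basis_matched n A B a b"
    unfolding indexed_basis_def basis_matched_def V_def by blast
qed

section \<open>Failure of matching for a proper intermediate field\<close>

lemma intermediate_field_not_matched:
  assumes M: "intermediate_field M" "range emb \<subset> M" "M \<subset> UNIV" "finite_dim_subspace M"
  shows "\<exists>n\<ge>1. \<exists>B. subspace_of_dim n M \<and> subspace_of_dim n B \<and> 1 \<notin> B \<and> \<not> subspace_matched n M B"
proof -
  have subM: "K.subspace M" "K.finite_dim M" using M(4) finite_dim_subspace_iff by auto
  have "emb 1 \<in> M" using M(2) by blast
  then have "1 \<in> M" by (simp add: emb_one)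
  then obtain D where D: "{1} \<subseteq> D" "D \<subseteq> M" "finite D" "K.independent D" "M \<subseteq> K.span D"
      "card D = K.dim M"
    using K.finite_dim_basis_extend[OF subM(2), of "{1}"] by auto
  have spanD: "K.span D = M" using D subM(1) by (simp add: K.span_subspace)
  obtain x where x: "x \<notin> M" using M(3) by blast
  define n where "n = card D"
  let ?D = "D - {1}"
  \<comment> \<open>\<open>?D\<close> spans a complement of \<open>K\<close> in \<open>M\<close>. In
    \<open>?B\<close> the basis vector 1 of \<open>M\<close> is replaced by \<open>x\<close>, which
    keeps the dimension but loses 1.\<close>
  let ?B = "K.span (insert x ?D)"
  have sub0: "K.span ?D \<subseteq> M" using K.span_mono[of ?D D] spanD by blast
  have "?D \<noteq> {}"
  proof
    assume "?D = {}"
    then have "D = {1}" using D(1) by blast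
    then show False using M(2) spanD range_emb by simp
  qed
  then have "card ?D > 0" using D(3) by (simp add: card_gt_0_iff)
  \<comment> \<open>Two indices are needed later, so that every \<open>b j\<close> occurs in a span
    omitting some other index.\<close>
  then have n2: "n \<ge> 2" unfolding n_def using D(1,3) by simp
  have dim0: "K.dim ?D = n - 1" and ind0: "K.independent ?D"
    using K.independent_mono[OF D(4), of ?D] D(1,3)
    by (auto simp: n_def K.dim_eq_card_independent)
  have "x \<notin> K.span ?D" using x sub0 by blast
  then have "K.dim ?B = n"
    using n2 dim0 D(3) by (simp add: K.dim_insert_finite K.finite_dim_finite)
  then have "subspace_of_dim n ?B"
    using D(3) by (simp add: subspace_of_dim_def finite_dim_subspace_iff K.finite_dim_finite)
  moreover have "1 \<notin> ?B"
  proof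
    assume "1 \<in> ?B"
    moreover have "1 \<notin> K.span ?D" using D(1,4) unfolding K.dependent_def by blast
    ultimately have "x \<in> K.span (insert 1 ?D)" by (rule K.in_span_insert)
    then show False using x spanD D(1) by (simp add: insert_absorb)
  qed
  moreover have "\<not> subspace_matched n M ?B"
  proof
    assume matched: "subspace_matched n M ?B"
    obtain a where a: "bij_betw a {1..n} D"
      using ex_bij_betw_nat_finite_1[OF D(3)] n_def by blast
    then have "indexed_basis n a M"
      unfolding indexed_basis_def using D(4) spanD by (simp add: bij_betw_def)
    then obtain b where b: "indexed_basis n b ?B" "basis_matched n M ?B a b"
      using matched unfolding subspace_matched_def by blast
    \<comment> \<open>\<open>M\<close> is closed under multiplication, so every
      \<open>d \<in> ?D\<close> satisfies \<open>a i * d \<in> M\<close> and matching puts it into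
      the span omitting \<open>b i\<close>. Both spans have dimension \<open>n - 1\<close>.\<close>
    have eq: "K.span ?D = K.span (b ` ({1..n} - {i}))" if i: "i \<in> {1..n}" for i
    proof (rule K.subspace_dim_eq)
      have "a i \<in> M" using a i D(2) by (auto simp: bij_betw_def)
      then have "a i * d \<in> M" if "d \<in> ?D" for d
        using M(1) D(2) that unfolding intermediate_field_def by blast
      then have "?D \<subseteq> K.span (b ` ({1..n} - {i}))"
        using b(2) i K.span_superset[of "insert x ?D"] unfolding basis_matched_def by blast
      then show "K.span ?D \<subseteq> K.span (b ` ({1..n} - {i}))" by (rule K.span_minimal) simp
      show "K.dim (K.span (b ` ({1..n} - {i}))) \<le> K.dim (K.span ?D)"
        using i dim0 by (subst indexed_basis_dim[OF b(1)]) auto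
    qed (auto simp: K.finite_dim_finite)
    \<comment> \<open>Any \<open>i \<noteq> j\<close> works: \<open>b j\<close> is among the
      generators of the span omitting \<open>b i\<close>. So \<open>?B\<close> collapses into
      \<open>M\<close>, although \<open>x\<close> is not there.\<close>
    have "b j \<in> K.span ?D" if j: "j \<in> {1..n}" for j
    proof -
      obtain i where i: "i \<in> {1..n}" "i \<noteq> j"
        using n2 that[of 1] that[of 2] by fastforce
      then show ?thesis unfolding eq[OF i(1)] using j by (intro K.span_base) auto
    qed
    then have "K.span (b ` {1..n}) \<subseteq> K.span ?D" by (intro K.span_minimal) auto
    then have "x \<in> K.span ?D"
      using b(1) K.span_base[of x "insert x ?D"] unfolding indexed_basis_def by blast
    then show False using x sub0 by blast
  qed
  moreover have "subspace_of_dim n M"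
    using M(4) D(6) unfolding subspace_of_dim_def n_def by simp
  ultimately show ?thesis using n2 by (intro exI[of _ n]) auto
qed

section \<open>The equivalence\<close>

lemma intermediate_field_subspace:
  assumes "intermediate_field M"
  shows "K.subspace M"
proof (rule K.subspaceI)
  have emb: "emb c \<in> M" for c using assms unfolding intermediate_field_def by blast
  have diff: "x - y \<in> M" and mult: "x * y \<in> M" if "x \<in> M" "y \<in> M" for x y
    using assms that unfolding intermediate_field_def by auto
  show zero: "0 \<in> M" using diff[OF emb emb] by (metis diff_self)
  show "x + y \<in> M" if "x \<in> M" "y \<in> M" for x y
    using diff[OF that(1) diff[OF zero that(2)]] by simp
  show "scale c x \<in> M" if "x \<in> M" for c x
    using mult[OF emb that] by (simp add: scale_def)
qed

theorem linear_matching_property_iff: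
  "linear_matching_property \<longleftrightarrow>
    \<not> (\<exists>M. intermediate_field M \<and> range emb \<subset> M \<and> M \<subset> UNIV \<and> finite_dim_subspace M)"
proof
  assume "linear_matching_property"
  then show "\<not> (\<exists>M. intermediate_field M \<and> range emb \<subset> M \<and> M \<subset> UNIV \<and> finite_dim_subspace M)"
    unfolding linear_matching_property_def using intermediate_field_not_matched by meson
next
  assume no: "\<not> (\<exists>M. intermediate_field M \<and> range emb \<subset> M \<and> M \<subset> UNIV \<and> finite_dim_subspace M)"
  have "M = range emb \<or> M = UNIV" if M: "intermediate_field M" "K.finite_dim M" for M
  proof -
    have "K.subspace M" using M(1) by (rule intermediate_field_subspace)
    moreover have "range emb \<subseteq> M" using M(1) by (simp add: intermediate_field_def)
    ultimately show ?thesis using no M finite_dim_subspace_iff by blast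
  qed
  then show "linear_matching_property"
    unfolding linear_matching_property_def subspace_of_dim_def finite_dim_subspace_iff
    by (intro allI impI subspace_matchedI) simp_all
qed

end

theorem theorem2p6:
  fixes emb :: "'k::field \<Rightarrow> 'l::division_ring"
  assumes "central_extension emb"
  shows "central_extension.linear_matching_property emb \<longleftrightarrow>
    \<not> (\<exists>M. central_extension.intermediate_field emb M \<and>
         range emb \<subset> M \<and> M \<subset> UNIV \<and>
         central_extension.finite_dim_subspace emb M)"
  using assms by (rule central_extension.linear_matching_property_iff)

end
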